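(* Let $N\ge2$ and let $u$ be a polynomial of degree at most $N+1$. Take either all upper or all lower signs throughout. Let $x_1<\dots<x_N$ be the roots of $L_N\mp L_{N-1}$, and let $u_N$ be the polynomial of degree at most $N$ with $u_N(-1)=u(-1)$ and $u_N'(x_k)=u'(x_k)$ for $k=1,\dots,N$. Then there is a constant $c$ such that for all $x$ $$(u-u_N)(x) = c\left[\frac{N^2}{N^2-1} (L_N \pm L_{N-1})(x)\,(x \mp 1) - \frac{N}{N^2-1}(L_N \mp L_{N-1})(x)\,(x \pm 1)\right].$$
   Context: $L_n$ denotes the Legendre polynomial of degree $n$ on $[-1,1]$, normalized by $L_n(1)=1$. *)

theory Defs
  imports "HOL-Analysis.Analysis" "HOL-Computational_Algebra.Polynomial"
begin

(* For n = 0 the orthogonality condition is vacuous and p is the constant 1. *)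
definition is_legendre :: "nat \<Rightarrow> real poly \<Rightarrow> bool" where
  "is_legendre n p \<longleftrightarrow>
     degree p = n \<and>
     (\<forall>q. degree q < n \<longrightarrow> integral {-1..1} (\<lambda>x. poly p x * poly q x) = 0) \<and>
     poly p 1 = 1"

definition legendre :: "nat \<Rightarrow> real poly" where
  "legendre n = (THE p. is_legendre n p)"

lemma integral_pderiv_mult:
  fixes p q :: "real poly"
  shows "integral {-1..1} (\<lambda>x. poly (pderiv p) x * poly q x) =
    poly p 1 * poly q 1 - poly p (-1) * poly q (-1)
      - integral {-1..1} (\<lambda>x. poly p x * poly (pderiv q) x)"
proof -
  have "((\<lambda>x. poly (pderiv (p * q)) x) has_integral (poly (p * q) 1 - poly (p * q) (-1))) {-1..1}"
    by (rule fundamental_theorem_of_calculus)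
      (simp_all add: has_field_derivative_at_within del: poly_mult
        flip: has_real_derivative_iff_has_vector_derivative)
  then have "integral {-1..1} (\<lambda>x. poly p x * poly (pderiv q) x + poly (pderiv p) x * poly q x)
      = poly p 1 * poly q 1 - poly p (-1) * poly q (-1)"
    by (simp add: pderiv_mult mult.commute integral_unique)
  moreover have "integral {-1..1} (\<lambda>x. poly p x * poly (pderiv q) x + poly (pderiv p) x * poly q x)
     = integral {-1..1} (\<lambda>x. poly p x * poly (pderiv q) x) + integral {-1..1} (\<lambda>x. poly (pderiv p) x * poly q x)"
    by (intro Henstock_Kurzweil_Integration.integral_add integrable_continuous_interval continuous_intros)
  ultimately show ?thesis by simp
qed

lemma degree_funpow_pderiv: "degree ((pderiv ^^ k) (p :: real poly)) = degree p - k"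
  by (induction k) (auto simp: degree_pderiv)

lemma order_funpow_pderiv:
  fixes p :: "real poly"
  assumes "p \<noteq> 0" "k \<le> order a p"
  shows "(pderiv ^^ k) p \<noteq> 0 \<and> order a ((pderiv ^^ k) p) = order a p - k"
  using assms(2)
proof (induction k)
  case 0 then show ?case using assms by simp
next
  case (Suc k)
  let ?r = "(pderiv ^^ k) p"
  have r: "?r \<noteq> 0" "order a ?r = order a p - k" using Suc by auto
  then have pos: "order a ?r \<noteq> 0" using Suc.prems by simp
  have "pderiv ?r \<noteq> 0"
  proof
    assume "pderiv ?r = 0"
    then have "degree ?r = 0" by (simp add: pderiv_eq_0_iff)
    then have "order a ?r = 0" using order_degree[OF r(1), of a] by simp
    then show False using pos by simp
  qed
  then show ?case using order_pderiv[of ?r a] pos r order_root[of ?r a] by auto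
qed

lemma ex1_is_legendre: "\<exists>!p. is_legendre n p"
proof -
  (* Existence by Rodrigues' formula: the n-th derivative of (x^2 - 1)^n, rescaled. *)
  define w :: "real poly" where "w = [:-1, 1:] * [:1, 1:]"
  define f where "f k = (pderiv ^^ k) (w ^ n)" for k
  have w0: "w \<noteq> 0" by (auto simp: w_def)
  have ord: "order a (w ^ n) = n" if "a = 1 \<or> a = -1" for a :: real
  proof -
    have "order a w = order a [:-1,1:] + order a [:1,1:]"
      unfolding w_def by (rule order_mult) (auto)
    moreover have "order 1 [:-1,1::real:] = 1" "order (-1) [:1,1::real:] = 1"
      using order_power_n_n[of "1::real" 1] order_power_n_n[of "-1::real" 1] by simp_all
    moreover have "order (-1) [:-1,1::real:] = 0" "order 1 [:1,1::real:] = 0"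
      by (auto intro!: order_0I)
    ultimately have "order a w = 1" using that by auto
    then show ?thesis using w0
      by (induction n) (auto simp: order_mult)
  qed
  have fn: "f k \<noteq> 0" "order a (f k) = n - k" if "k \<le> n" "a = 1 \<or> a = -1" for k and a :: real
    using order_funpow_pderiv[of "w ^ n" k a] ord[of a] w0 that by (auto simp: f_def)
  have degw: "degree w = 2" by (simp add: w_def)
  have degf: "degree (f n) = n"
    by (simp add: f_def degree_funpow_pderiv degree_power_eq w0 degw)
  have f1: "poly (f n) 1 \<noteq> 0" using fn[of n 1] order_root[of "f n" 1] by auto
  have fz: "poly (f k) a = 0" if "k < n" "a = 1 \<or> a = -1" for k a
    using fn[of k a] that by (auto simp: order_root)
  have parts: "integral {-1..1} (\<lambda>x. poly (f n) x * poly q x)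
      = (-1) ^ k * integral {-1..1} (\<lambda>x. poly (f (n - k)) x * poly ((pderiv ^^ k) q) x)"
    if "k \<le> n" for k q
    using that
  proof (induction k)
    case (Suc k)
    have "f (n - k) = pderiv (f (n - Suc k))"
      unfolding f_def Suc_diff_Suc[OF Suc_le_lessD[OF Suc.prems], symmetric] by simp
    then show ?case
      using Suc fz[of "n - Suc k" 1] fz[of "n - Suc k" "-1"]
      by (simp add: integral_pderiv_mult)
  qed simp
  have orth: "integral {-1..1} (\<lambda>x. poly (f n) x * poly q x) = 0" if "degree q < n" for q
  proof -
    have "degree ((pderiv ^^ (n - 1)) q) = 0" using that by (simp add: degree_funpow_pderiv)
    then have "pderiv ((pderiv ^^ (n - 1)) q) = 0" by (simp add: pderiv_eq_0_iff)
    moreover have "(pderiv ^^ n) q = pderiv ((pderiv ^^ (n - 1)) q)"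
      using that by (cases n) auto
    ultimately show ?thesis using parts[of n q] by simp
  qed
  have ex: "is_legendre n (smult (inverse (poly (f n) 1)) (f n))"
    using f1 degf orth by (auto simp: is_legendre_def mult.assoc)
  have "p = q" if p: "is_legendre n p" and q: "is_legendre n q" for p q
  proof -
    have nz: "p \<noteq> 0" "q \<noteq> 0" using p q by (auto simp: is_legendre_def)
    define c where "c = lead_coeff p / lead_coeff q"
    define d where "d = p - smult c q"
    have cf: "coeff d n = 0"
      using p q nz leading_coeff_0_iff[of q] by (auto simp: d_def c_def is_legendre_def)
    have degd: "degree d \<le> n"
      using p q by (auto simp: d_def is_legendre_def intro!: degree_diff_le order.trans[OF degree_smult_le])
    have "d = 0"
    proof (cases "n = 0")
      case True
      then show ?thesis using cf degd by (metis le_zero_eq leading_coeff_0_iff)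
    next
      case False
      then have lt: "degree d < n" using cf degd
        by (metis degree_0 le_neq_implies_less leading_coeff_0_iff neq0_conv)
      have "integral {-1..1} (\<lambda>x. poly d x * poly d x)
          = integral {-1..1} (\<lambda>x. poly p x * poly d x - c * (poly q x * poly d x))"
        by (simp add: d_def algebra_simps)
      also have "\<dots> = integral {-1..1} (\<lambda>x. poly p x * poly d x) - integral {-1..1} (\<lambda>x. c * (poly q x * poly d x))"
        by (intro Henstock_Kurzweil_Integration.integral_diff integrable_continuous_interval continuous_intros)
      also have "\<dots> = 0" using p q lt by (simp add: is_legendre_def)
      finally have "\<forall>x\<in>{-1..1}. poly d x * poly d x = 0"
        by (subst (asm) integral_eq_0_iff) (auto intro!: continuous_on_mult continuous_on_poly continuous_on_id)
      then have "{-1..1} \<subseteq> {x. poly d x = 0}" by auto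
      moreover have "infinite {-1..1::real}" by (rule infinite_Icc) simp
      ultimately have "infinite {x. poly d x = 0}" by (rule infinite_super)
      then show ?thesis using poly_roots_finite[of d] by blast
    qed
    then have "p = smult c q" by (simp add: d_def)
    moreover from this have "c = 1" using p q by (auto simp: is_legendre_def)
    ultimately show ?thesis by simp
  qed
  with ex show ?thesis by blast
qed

lemma is_legendre_legendre: "is_legendre n (legendre n)"
  unfolding legendre_def by (rule theI'[OF ex1_is_legendre])

end

(* With A = L_N + s L_{N-1} and B = L_N - s L_{N-1}, both (x - s) A' = N B and (x + s) B' = N A hold,
   because (x - s) A' - N B has degree below N, is orthogonal to all polynomials of degree below
   N - 1, and vanishes at s. Hence the bracket of the theorem has derivative N B and vanishes at -1.
   The derivative of u - u_N has degree at most N and vanishes at the N roots of B, so it is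
   a multiple of B, and u - u_N is a multiple of the bracket. *)
theory Submission
  imports Defs
begin

text \<open>As a functional on polynomials, the integral lets orthogonality arguments run through
  identities in the ring \<open>real poly\<close>.\<close>

definition pint :: "real poly \<Rightarrow> real" where
  "pint p = integral {-1..1} (poly p)"

lemma pint_cong: "(\<And>x. poly p x = f x) \<Longrightarrow> pint p = integral {-1..1} f"
  unfolding pint_def by (rule integral_cong)

lemma pint_add: "pint (p + q) = pint p + pint q"
  unfolding pint_def poly_add
  by (intro Henstock_Kurzweil_Integration.integral_add integrable_continuous_interval continuous_intros)

lemma pint_diff: "pint (p - q) = pint p - pint q"
  unfolding pint_def poly_diff
  by (intro Henstock_Kurzweil_Integration.integral_diff integrable_continuous_interval continuous_intros)

lemma pint_smult: "pint (smult c p) = c * pint p"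
  by (subst pint_cong[OF poly_smult]) (simp add: pint_def)

lemma pint_pderiv: "pint (pderiv p) = poly p 1 - poly p (-1)"
  using integral_pderiv_mult[of p 1] by (simp add: pint_def)

lemma pint_reflect: "pint (pcompose p [:0, -1:]) = pint p"
  using Henstock_Kurzweil_Integration.integral_reflect_real[of 1 "-1" "poly p"]
  by (subst pint_cong[where f = "\<lambda>x. poly p (-x)"]) (simp_all add: pint_def poly_pcompose)

text \<open>A continuous nonnegative function with integral 0 vanishes on the interval, which gives
  \<open>p\<close> infinitely many roots.\<close>

lemma pint_square_eq_0D:
  assumes "pint (p * p) = 0"
  shows "p = 0"
proof -
  have "\<forall>x\<in>{-1..1}. poly (p * p) x = 0"
    using assms unfolding pint_def
    by (subst (asm) integral_eq_0_iff) (auto intro!: continuous_intros)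
  then have "{-1..1} \<subseteq> {x. poly p x = 0}" by auto
  moreover have "infinite {-1..1::real}" by (rule infinite_Icc) simp
  ultimately have "infinite {x. poly p x = 0}" by (rule infinite_super)
  then show ?thesis using poly_roots_finite[of p] by blast
qed

text \<open>The multiple of \<open>q\<close> is chosen to cancel the coefficient at
  \<open>degree q\<close>. Writing \<open>coeff p (degree q)\<close> instead of
  \<open>lead_coeff p\<close> also covers \<open>p\<close> of smaller degree, where the multiple is
  0.\<close>

lemma degree_diff_smult_less:
  fixes p q :: "'a::field poly"
  assumes "degree p \<le> degree q" "degree q > 0"
  shows "degree (p - smult (coeff p (degree q) / lead_coeff q) q) < degree q"
proof (rule degree_lessI)
  show "p - smult (coeff p (degree q) / lead_coeff q) q \<noteq> 0 \<or> degree q > 0"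
    using assms by simp
  show "\<forall>k\<ge>degree q. coeff (p - smult (coeff p (degree q) / lead_coeff q) q) k = 0"
  proof (intro allI impI)
    fix k assume "degree q \<le> k"
    then consider "k = degree q" | "k > degree q" by linarith
    then show "coeff (p - smult (coeff p (degree q) / lead_coeff q) q) k = 0"
      using assms by cases (auto simp: coeff_eq_0)
  qed
qed

lemma degree_legendre: "degree (legendre n) = n"
  using is_legendre_legendre[of n] by (simp add: is_legendre_def)

lemma poly_legendre_1: "poly (legendre n) 1 = 1"
  using is_legendre_legendre[of n] by (simp add: is_legendre_def)

lemma pint_legendre_mult: "degree q < n \<Longrightarrow> pint (legendre n * q) = 0"
  using is_legendre_legendre[of n] by (subst pint_cong[OF poly_mult]) (simp add: is_legendre_def)

text \<open>After the top coefficient is cancelled, the remainder \<open>d\<close> has degree below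
  \<open>n\<close>. Both \<open>p\<close> and \<open>legendre n\<close> are then orthogonal to
  \<open>d\<close>, so \<open>d\<close> is orthogonal to itself.\<close>

lemma orthogonal_imp_smult_legendre:
  assumes "n > 0" "degree p \<le> n" and orth: "\<And>q. degree q < n \<Longrightarrow> pint (p * q) = 0"
  shows "p = smult (coeff p n / lead_coeff (legendre n)) (legendre n)"
proof -
  define c where "c = coeff p n / lead_coeff (legendre n)"
  define d where "d = p - smult c (legendre n)"
  have deg: "degree d < n"
    using degree_diff_smult_less[of p "legendre n"] assms
    by (simp add: d_def c_def degree_legendre)
  \<comment> \<open>Only the left factor of \<open>d * d\<close> is expanded; the right one stays as
    the low-degree test polynomial.\<close>
  have "(p - smult c (legendre n)) * d = p * d - smult c (legendre n * d)"
    by (simp add: left_diff_distrib)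
  then have "d * d = p * d - smult c (legendre n * d)" by (simp flip: d_def)
  then have "pint (d * d) = 0"
    using orth[OF deg] pint_legendre_mult[OF deg] by (simp add: pint_diff pint_smult)
  then have "d = 0" by (rule pint_square_eq_0D)
  then show ?thesis by (simp add: d_def c_def)
qed

text \<open>The reflection of \<open>x\<close> to \<open>-x\<close> preserves the integral and the
  degree, so it turns \<open>legendre n\<close> into a multiple of itself. Comparing leading
  coefficients gives the factor \<open>(-1) ^ n\<close>.\<close>

lemma poly_legendre_minus_1: "poly (legendre n) (-1) = (-1) ^ n"
proof (cases "n = 0")
  case True
  obtain a where "legendre 0 = [:a:]" using degree_legendre[of 0] by (rule degree_eq_zeroE)
  then show ?thesis using True poly_legendre_1[of 0] by simp
next
  case False
  define p where "p = pcompose (legendre n) [:0, -1:]"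
  have deg: "degree p = n" by (simp add: p_def degree_legendre degree_pcompose)
  have "pint (p * q) = 0" if "degree q < n" for q
  proof -
    \<comment> \<open>Reflection is an involution, so it takes \<open>p\<close> back to
      \<open>legendre n\<close> and moves the sign change onto \<open>q\<close>.\<close>
    have "pcompose (p * q) [:0, -1:] = legendre n * pcompose q [:0, -1:]"
      by (simp add: p_def poly_pcompose fun_eq_iff flip: poly_eq_poly_eq_iff)
    then have "pint (p * q) = pint (legendre n * pcompose q [:0, -1:])"
      by (metis pint_reflect)
    also have "\<dots> = 0"
      using that by (intro pint_legendre_mult) (simp add: degree_pcompose)
    finally show ?thesis .
  qed
  then have "p = smult (coeff p n / lead_coeff (legendre n)) (legendre n)"
    using False deg by (intro orthogonal_imp_smult_legendre) auto
  moreover have "coeff p n = (-1) ^ n * lead_coeff (legendre n)"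
    using lead_coeff_comp[of "[:0, -1:]" "legendre n"] deg
    by (simp add: p_def degree_legendre)
  moreover have "lead_coeff (legendre n) \<noteq> 0"
    using poly_legendre_1[of n] by auto
  ultimately have "p = smult ((-1) ^ n) (legendre n)" by simp
  then have "poly p 1 = (-1) ^ n" by (simp add: poly_legendre_1)
  then show ?thesis by (simp add: p_def poly_pcompose)
qed

text \<open>In the notation of the overview, these equations say that \<open>B\<close> vanishes at
  \<open>s\<close> and \<open>A\<close> at \<open>-s\<close>.\<close>

lemma poly_legendre_sign:
  assumes "s = 1 \<or> s = -1" "n > 0"
  shows "poly (legendre n) s = s * poly (legendre (n - 1)) s"
    and "poly (legendre n) (-s) = - s * poly (legendre (n - 1)) (-s)"
  using assms by (cases n; auto simp: poly_legendre_1 poly_legendre_minus_1)+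

text \<open>Since \<open>s\<close> is arbitrary among the two signs, replacing it by
  \<open>-s\<close> swaps the two combinations, so this one identity covers both relations of the
  overview.\<close>

lemma pderiv_legendre_sum:
  assumes s: "s = 1 \<or> s = -1" and "n \<ge> 2"
  shows "[:-s, 1:] * pderiv (legendre n + smult s (legendre (n - 1))) =
    smult (real n) (legendre n - smult s (legendre (n - 1)))"
proof -
  define A where "A = legendre n + smult s (legendre (n - 1))"
  define B where "B = legendre n - smult s (legendre (n - 1))"
  define P where "P = [:-s, 1:] * pderiv A - smult (real n) B"
  have degA: "degree A \<le> n" and degB: "degree B \<le> n"
    by (auto simp: A_def B_def degree_legendre
        intro!: degree_add_le degree_diff_le order.trans[OF degree_smult_le])
  have "degree ([:-s, 1:] * pderiv A) \<le> 1 + (n - 1)"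
    using degA by (intro order.trans[OF degree_mult_le] add_mono) (auto simp: degree_pderiv)
  then have "degree P \<le> n"
    using degB \<open>n \<ge> 2\<close> by (auto simp: P_def intro!: degree_diff_le order.trans[OF degree_smult_le])
  \<comment> \<open>Differentiation multiplies the leading coefficient of \<open>legendre n\<close>
    by \<open>n\<close>, which is just what \<open>smult (real n) B\<close> removes.\<close>
  moreover have "coeff P n = 0"
    using \<open>n \<ge> 2\<close> degree_legendre[of n] degree_legendre[of "n - 1"]
    by (cases n) (simp_all add: P_def A_def B_def coeff_pderiv coeff_eq_0)
  ultimately have "coeff P i = 0" if "i > n - 1" for i
    using that by (cases "i = n") (auto intro: coeff_eq_0)
  then have degP: "degree P \<le> n - 1" by (intro degree_le) simp
  have orth: "pint (P * q) = 0" if q: "degree q < n - 1" for q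
  proof -
    \<comment> \<open>The factor \<open>x - s\<close> goes to the test polynomial before integrating
      by parts: \<open>r\<close> vanishes at \<open>s\<close> and \<open>A\<close> at
      \<open>-s\<close>, so no boundary term survives, and \<open>pderiv r\<close> again has degree
      below \<open>n - 1\<close>.\<close>
    define r where "r = [:-s, 1:] * q"
    have "degree r \<le> 1 + degree q"
      unfolding r_def by (rule order.trans[OF degree_mult_le]) simp
    then have degr: "degree (pderiv r) < n - 1" using q by (simp add: degree_pderiv)
    have low: "pint (A * t) = 0" "pint (B * t) = 0" if "degree t < n - 1" for t
      using that pint_legendre_mult[of t n] pint_legendre_mult[of t "n - 1"]
      by (simp_all add: A_def B_def algebra_simps pint_add pint_diff pint_smult)
    have "poly A (-s) = 0"
      using poly_legendre_sign(2)[OF s, of n] \<open>n \<ge> 2\<close> by (simp add: A_def)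
    then have "pint (pderiv (A * r)) = 0"
      using s by (auto simp: pint_pderiv r_def)
    moreover have "P * q = pderiv (A * r) - A * pderiv r - smult (real n) (B * q)"
      unfolding P_def r_def pderiv_mult[of A] by (simp add: algebra_simps)
    ultimately show ?thesis
      using low(1)[OF degr] low(2)[OF q] by (simp add: pint_diff pint_smult)
  qed
  define c where "c = coeff P (n - 1) / lead_coeff (legendre (n - 1))"
  have P: "P = smult c (legendre (n - 1))"
    unfolding c_def using degP orth \<open>n \<ge> 2\<close> by (intro orthogonal_imp_smult_legendre) auto
  \<comment> \<open>At \<open>s\<close> both \<open>x - s\<close> and \<open>B\<close> vanish,
    whereas \<open>legendre (n - 1)\<close> does not; this forces the factor \<open>c\<close> to be
    0.\<close>
  have "poly P s = 0"
    using poly_legendre_sign(1)[OF s, of n] \<open>n \<ge> 2\<close> by (simp add: P_def B_def)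
  moreover have "poly (legendre (n - 1)) s \<noteq> 0"
    using s by (auto simp: poly_legendre_1 poly_legendre_minus_1)
  ultimately have "P = 0" using P by auto
  then show ?thesis by (simp add: P_def A_def B_def)
qed

text \<open>Cancelling the top coefficient leaves a polynomial of degree below \<open>card S\<close>
  that still vanishes on \<open>S\<close>, hence 0.\<close>

lemma eq_smult_if_common_roots:
  fixes p q :: "'a::field poly"
  assumes "degree p \<le> degree q" "degree q > 0" "card S = degree q"
    and "\<And>z. z \<in> S \<Longrightarrow> poly p z = 0" "\<And>z. z \<in> S \<Longrightarrow> poly q z = 0"
  obtains c where "p = smult c q"
proof -
  define c where "c = coeff p (degree q) / lead_coeff q"
  define d where "d = p - smult c q"
  have deg: "degree d < degree q"
    unfolding d_def c_def using assms(1,2) by (rule degree_diff_smult_less)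
  have "d = 0"
  proof (rule ccontr)
    assume "d \<noteq> 0"
    then have "card S \<le> card {z. poly d z = 0}"
      using assms(4,5) by (intro card_mono poly_roots_finite) (auto simp: d_def)
    also have "\<dots> \<le> degree d" by (rule card_poly_roots_bound[OF \<open>d \<noteq> 0\<close>])
    finally show False using deg assms(3) by simp
  qed
  then show ?thesis using that[of c] by (simp add: d_def)
qed

theorem theorem3p3:
  fixes N :: nat and s :: real and u uN :: "real poly" and x :: "nat \<Rightarrow> real"
  assumes "N \<ge> 2"
    and "degree u \<le> N + 1"
    and sign: "s = 1 \<or> s = -1"
    and "strict_mono_on {1..N} x"
    and "x ` {1..N} = {z. poly (legendre N - smult s (legendre (N - 1))) z = 0}"
    and "degree uN \<le> N"
    and "poly uN (-1) = poly u (-1)"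
    and "\<And>k. k \<in> {1..N} \<Longrightarrow> poly (pderiv uN) (x k) = poly (pderiv u) (x k)"
  shows "\<exists>c. \<forall>y. poly (u - uN) y =
    c * ((real N)\<^sup>2 / ((real N)\<^sup>2 - 1)
            * poly (legendre N + smult s (legendre (N - 1))) y * (y - s)
         - real N / ((real N)\<^sup>2 - 1)
            * poly (legendre N - smult s (legendre (N - 1))) y * (y + s))"
proof -
  define A where "A = legendre N + smult s (legendre (N - 1))"
  define B where "B = legendre N - smult s (legendre (N - 1))"
  \<comment> \<open>The bracket of the theorem is \<open>N / (N^2 - 1)\<close> times
    \<open>G\<close>.\<close>
  define G where "G = smult (real N) (A * [:-s, 1:]) - B * [:s, 1:]"
  define e where "e = u - uN"
  have N1: "(real N)\<^sup>2 - 1 \<noteq> 0"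
    using \<open>N \<ge> 2\<close> by (auto simp: power2_eq_1_iff)
  have degB: "degree B = N"
    using \<open>N \<ge> 2\<close> degree_add_eq_left[of "smult (-s) (legendre (N - 1))" "legendre N"]
    by (simp add: B_def degree_legendre)
  have "inj_on x {1..N}"
    using assms(4) by (rule strict_mono_on_imp_inj_on)
  then have card: "card (x ` {1..N}) = degree B"
    by (simp add: card_image degB)
  have "degree e \<le> N + 1"
    using assms(2,6) by (auto simp: e_def intro!: degree_diff_le)
  then have deg_e: "degree (pderiv e) \<le> degree B" by (simp add: degree_pderiv degB)
  have e0: "poly (pderiv e) z = 0" if "z \<in> x ` {1..N}" for z
    using that assms(8) by (auto simp: e_def pderiv_diff)
  have B0: "poly B z = 0" if "z \<in> x ` {1..N}" for z
    using that assms(5) by (simp add: B_def)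
  have "degree B > 0" using degB \<open>N \<ge> 2\<close> by simp
  then obtain c where c: "pderiv e = smult c B"
    using eq_smult_if_common_roots[OF deg_e _ card e0 B0] by blast
  have A': "[:-s, 1:] * pderiv A = smult (real N) B"
    using pderiv_legendre_sum[OF sign \<open>N \<ge> 2\<close>] by (simp add: A_def B_def)
  \<comment> \<open>The same identity at \<open>-s\<close>, where \<open>A\<close> and
    \<open>B\<close> change places.\<close>
  have B': "[:s, 1:] * pderiv B = smult (real N) A"
    using pderiv_legendre_sum[of "-s" N] sign \<open>N \<ge> 2\<close> by (auto simp: A_def B_def)
  have "pderiv G = smult (real N) (A + [:-s, 1:] * pderiv A) - (B + [:s, 1:] * pderiv B)"
    unfolding G_def pderiv_diff pderiv_smult pderiv_mult
    by (simp add: pderiv_pCons algebra_simps)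
  \<comment> \<open>The two terms \<open>N A\<close> cancel, leaving
    \<open>N^2 B - B\<close>.\<close>
  also have "\<dots> = smult ((real N)\<^sup>2 - 1) B"
    unfolding A' B' by (simp add: smult_add_right smult_diff_left power2_eq_square)
  finally have G': "pderiv G = smult ((real N)\<^sup>2 - 1) B" .
  define k where "k = c / ((real N)\<^sup>2 - 1)"
  have "pderiv (e - smult k G) = 0"
    using N1 by (simp add: pderiv_diff pderiv_smult c G' k_def)
  then obtain h where h: "e - smult k G = [:h:]"
    using pderiv_eq_0_iff degree_eq_zeroE by metis
  \<comment> \<open>For \<open>s = 1\<close> the zeros at \<open>-1\<close> come from
    \<open>A\<close> and \<open>x + s\<close>; for \<open>s = -1\<close> they come from
    \<open>x - s\<close> and \<open>B\<close>.\<close>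
  have "poly G (-1) = 0"
    using sign poly_legendre_minus_1[of N] poly_legendre_minus_1[of "N - 1"] \<open>N \<ge> 2\<close>
    by (cases N) (auto simp: G_def A_def B_def)
  moreover have "poly e (-1) = 0" using assms(7) by (simp add: e_def)
  ultimately have "poly (e - smult k G) (-1) = 0" by simp
  then have "e = smult k G" using h by simp
  \<comment> \<open>The constant is \<open>k\<close> divided by the factor
    \<open>N / (N^2 - 1)\<close> that relates \<open>G\<close> to the bracket.\<close>
  then have "poly e y = (c / real N) * ((real N)\<^sup>2 / ((real N)\<^sup>2 - 1) * poly A y * (y - s)
         - real N / ((real N)\<^sup>2 - 1) * poly B y * (y + s))" for y
    using \<open>N \<ge> 2\<close> by (simp add: G_def k_def power2_eq_square add_divide_distrib diff_divide_distrib algebra_simps)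
  then show ?thesis unfolding e_def A_def B_def by blast
qed

end
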